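(* Let $(X,\mathcal{C})$ be a $2$-flimsy connectivity space. For any distinct $x,y\in X$, the subset $X\setminus\{x,y\}$ has exactly two $\mathcal{C}$-components.
   Context: A connectivity space is a pair $(X,\mathcal{C})$ where $X$ is a set and $\mathcal{C}$ is a set of subsets of $X$ such that: (C1) for any $x\in X$, $\{x\}\in\mathcal{C}$; (C2) for any $C\subseteq\mathcal{C}$, if $\bigcap C\neq\varnothing$ then $\bigcup C\in\mathcal{C}$ (in particular, by convention, $\varnothing\in\mathcal{C}$); (C3) for any $Y\in\mathcal{C}$ and any $x,y\in Y$, the subset $C:=\bigcup\{Z\in\mathcal{C} : y\in Z \text{ and } Z\subseteq Y\setminus\{x\}\}$ satisfies $Y\setminus C\in\mathcal{C}$; (C4) for any non-empty $A,B\in\mathcal{C}$ such that $A\cup B\in\mathcal{C}$, at least one of the following holds: (i) there exists $x\in A\cup B$ such that $A\cup\{x\}\in\mathcal{C}$ and $B\cup\{x\}\in\mathcal{C}$; or (ii) there exists $S\in\mathcal{C}$ with $S\subseteq A\cup B$ such that $S\cap A\notin\mathcal{C}$ or $S\cap B\notin\mathcal{C}$. A subset $Y\subseteq X$ is $\mathcal{C}$-connected when $Y\in\mathcal{C}$. The $\mathcal{C}$-components of a subset $Y\subseteq X$ are its maximal $\mathcal{C}$-connected subsets (for non-empty $Y$); they partition $Y$. A connectivity space $(X,\mathcal{C})$ is $2$-flimsy if $|X|>2$ and if, for any $S\subseteq X$, $X\setminus S\in\mathcal{C}$ whenever $|S|<2$ and $X\setminus S\notin\mathcal{C}$ whenever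 $|S|=2$. *)

theory Defs
  imports Main
begin

text \<open>
  A connectivity space on a carrier set \<open>X\<close>, with \<open>\<C>\<close> the set of connected subsets.
  In \<open>C2\<close> the empty family is allowed: \<open>\<Inter>{}\<close> is \<open>UNIV\<close>, which is never empty,
  so \<open>C2\<close> yields \<open>{} \<in> \<C>\<close>, the intended convention.
\<close>

locale connectivity_space =
  fixes X :: "'a set" and \<C> :: "'a set set"
  assumes subsets: "\<C> \<subseteq> Pow X"
    and C1: "\<And>x. x \<in> X \<Longrightarrow> {x} \<in> \<C>"
    and C2: "\<And>\<K>. \<K> \<subseteq> \<C> \<Longrightarrow> \<Inter>\<K> \<noteq> {} \<Longrightarrow> \<Union>\<K> \<in> \<C>"
    and C3: "\<And>Y x y. Y \<in> \<C> \<Longrightarrow> x \<in> Y \<Longrightarrow> y \<in> Y \<Longrightarrow>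
               Y - \<Union>{Z \<in> \<C>. y \<in> Z \<and> Z \<subseteq> Y - {x}} \<in> \<C>"
    and C4: "\<And>A B. A \<in> \<C> \<Longrightarrow> B \<in> \<C> \<Longrightarrow> A \<noteq> {} \<Longrightarrow> B \<noteq> {} \<Longrightarrow> A \<union> B \<in> \<C> \<Longrightarrow>
               (\<exists>x \<in> A \<union> B. A \<union> {x} \<in> \<C> \<and> B \<union> {x} \<in> \<C>) \<or>
               (\<exists>S \<in> \<C>. S \<subseteq> A \<union> B \<and> (S \<inter> A \<notin> \<C> \<or> S \<inter> B \<notin> \<C>))"

text \<open>
  The notion of component is meant for non-empty \<open>Y\<close> only; for \<open>Y = {}\<close> this
  definition would return the single set \<open>{}\<close>.
\<close>

definition conn_components :: "'a set set \<Rightarrow> 'a set \<Rightarrow> 'a set set" where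
  "conn_components \<C> Y =
     {Z. Z \<in> \<C> \<and> Z \<subseteq> Y \<and> (\<forall>W. W \<in> \<C> \<longrightarrow> W \<subseteq> Y \<longrightarrow> Z \<subseteq> W \<longrightarrow> W = Z)}"

text \<open>
  \<open>X\<close> may be infinite, and \<open>card\<close> is \<open>0\<close> on infinite sets; hence the explicit
  (in)finiteness conditions.
\<close>

locale two_flimsy_space = connectivity_space +
  assumes size: "infinite X \<or> card X > 2"
    and connected_minus: "\<And>S. S \<subseteq> X \<Longrightarrow> finite S \<Longrightarrow> card S < 2 \<Longrightarrow> X - S \<in> \<C>"
    and disconnected_minus: "\<And>S. S \<subseteq> X \<Longrightarrow> finite S \<Longrightarrow> card S = 2 \<Longrightarrow> X - S \<notin> \<C>"

end

theory Submission
  imports Defs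
begin

text \<open>
  Since \<open>X - {x, y}\<close> is not connected, it has at least two components. Suppose that it had
  three: distinct components \<open>A\<close>, \<open>B\<close> and a point \<open>r\<close> outside both. Fix \<open>a \<in> A\<close> and \<open>b \<in> B\<close>.
  The picture is that of a theta graph: after removal of \<open>a\<close>, every remaining point of \<open>A\<close> is
  still joined to \<open>x\<close> or to \<open>y\<close>, and \<open>x\<close> and \<open>y\<close> are still joined through the components
  other than \<open>A\<close> and \<open>B\<close>. Hence \<open>X - {a} - B\<close> is connected
  (lemma \<open>minus_point_minus_component\<close>), and by symmetry
  so is \<open>X - {b} - A\<close>. Both contain \<open>r\<close>, so their union \<open>X - {a, b}\<close> is connected,
  which contradicts 2-flimsiness.

  The connected sets needed on the way all come from the third axiom: if \<open>Y\<close> is connected, it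
  stays connected when a component of \<open>Y - {p}\<close> is cut off (lemma \<open>minus_component_connected\<close>).
\<close>

text \<open>
  The union of all connected subsets of \<open>S\<close> through \<open>p\<close>; it is the component of \<open>p\<close> in \<open>S\<close>
  when \<open>p \<in> S \<subseteq> X\<close>, and it is empty when \<open>p \<notin> S\<close>.
\<close>

definition component_of :: "'a set set \<Rightarrow> 'a set \<Rightarrow> 'a \<Rightarrow> 'a set" where
  "component_of \<C> S p = \<Union>{Z \<in> \<C>. p \<in> Z \<and> Z \<subseteq> S}"

lemma component_of_subset: "component_of \<C> S p \<subseteq> S"
  unfolding component_of_def by blast

lemma component_of_upper: "Z \<in> \<C> \<Longrightarrow> p \<in> Z \<Longrightarrow> Z \<subseteq> S \<Longrightarrow> Z \<subseteq> component_of \<C> S p"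
  unfolding component_of_def by blast

lemma component_of_mono: "S \<subseteq> T \<Longrightarrow> component_of \<C> S p \<subseteq> component_of \<C> T p"
  unfolding component_of_def by blast

context connectivity_space
begin

lemma Un_connected:
  assumes "A \<in> \<C>" "B \<in> \<C>" "p \<in> A" "p \<in> B"
  shows "A \<union> B \<in> \<C>"
  using C2[of "{A, B}"] assms by auto

lemma component_of_connected: "component_of \<C> S p \<in> \<C>"
proof -
  have "p \<in> \<Inter>{Z \<in> \<C>. p \<in> Z \<and> Z \<subseteq> S}" by blast
  then show ?thesis unfolding component_of_def by (intro C2) blast+
qed

lemma component_of_self:
  assumes "p \<in> S" "S \<subseteq> X"
  shows "p \<in> component_of \<C> S p"
proof -
  have "{p} \<in> \<C>" using assms C1 by blast
  then have "{p} \<subseteq> component_of \<C> S p" by (rule component_of_upper) (use assms in auto)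
  then show ?thesis by simp
qed

lemma component_of_eq:
  assumes "q \<in> component_of \<C> S p" "S \<subseteq> X"
  shows "component_of \<C> S q = component_of \<C> S p"
proof
  have "p \<in> S" using assms unfolding component_of_def by blast
  have le: "component_of \<C> S p \<subseteq> component_of \<C> S q"
    by (rule component_of_upper[OF component_of_connected assms(1) component_of_subset])
  then show "component_of \<C> S p \<subseteq> component_of \<C> S q" .
  have "p \<in> component_of \<C> S q" using le component_of_self[OF \<open>p \<in> S\<close> assms(2)] by blast
  then show "component_of \<C> S q \<subseteq> component_of \<C> S p"
    by (rule component_of_upper[OF component_of_connected _ component_of_subset])
qed

lemma minus_component_connected:
  assumes "Y \<in> \<C>" "p \<in> Y" "q \<in> Y"
  shows "Y - component_of \<C> (Y - {p}) q \<in> \<C>"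
  using C3[OF assms] unfolding component_of_def .

lemma conn_components_eq:
  assumes "S \<subseteq> X" "S \<noteq> {}"
  shows "conn_components \<C> S = component_of \<C> S ` S"
proof
  show "component_of \<C> S ` S \<subseteq> conn_components \<C> S"
  proof
    fix Z assume "Z \<in> component_of \<C> S ` S"
    then obtain p where p: "p \<in> S" "Z = component_of \<C> S p" by blast
    have "Z \<in> \<C>" "Z \<subseteq> S"
      unfolding p(2) by (rule component_of_connected component_of_subset)+
    moreover have "W = Z" if "W \<in> \<C>" "W \<subseteq> S" "Z \<subseteq> W" for W
      using that p component_of_self[OF p(1) assms(1)] component_of_upper[of W \<C> p S] by blast
    ultimately show "Z \<in> conn_components \<C> S"
      unfolding conn_components_def by simp
  qed
next
  show "conn_components \<C> S \<subseteq> component_of \<C> S ` S"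
  proof
    fix Z assume "Z \<in> conn_components \<C> S"
    then have Z: "Z \<in> \<C>" "Z \<subseteq> S" "\<And>W. W \<in> \<C> \<Longrightarrow> W \<subseteq> S \<Longrightarrow> Z \<subseteq> W \<Longrightarrow> W = Z"
      unfolding conn_components_def by blast+
    have "Z \<noteq> {}"
    proof
      assume "Z = {}"
      obtain p where "p \<in> S" using assms by blast
      then have "{p} = Z" using Z(3)[of "{p}"] C1 assms \<open>Z = {}\<close> by blast
      then show False using \<open>Z = {}\<close> by simp
    qed
    then obtain p where p: "p \<in> Z" by blast
    have "component_of \<C> S p = Z"
      by (rule Z(3)[OF component_of_connected component_of_subset component_of_upper])
        (use Z p in auto)
    then show "Z \<in> component_of \<C> S ` S" using p Z(2) by blast
  qed
qed

end

context two_flimsy_space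
begin

lemma minus_one: "p \<in> X \<Longrightarrow> X - {p} \<in> \<C>"
  by (rule connected_minus) auto

lemma minus_two: "p \<in> X \<Longrightarrow> q \<in> X \<Longrightarrow> p \<noteq> q \<Longrightarrow> X - {p, q} \<notin> \<C>"
  by (rule disconnected_minus) auto

lemma minus_two_nonempty:
  assumes "x \<in> X" "y \<in> X"
  shows "X - {x, y} \<noteq> {}"
proof
  assume "X - {x, y} = {}"
  then have "X \<subseteq> {x, y}" by blast
  then have "finite X" "card X \<le> card {x, y}" by (auto intro: finite_subset card_mono)
  moreover have "card {x, y} \<le> 2" by (simp add: card_insert_if)
  ultimately show False using size by linarith
qed

text \<open>
  The component of \<open>y\<close> in \<open>X - {a, x}\<close> contains all components of \<open>X - {x, y}\<close> that avoid \<open>a\<close>,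
  because these form a connected set together with \<open>y\<close>. One of them can then be cut off at \<open>y\<close>.
\<close>

lemma component_around_end:
  assumes x: "x \<in> X" and y: "y \<in> X" and "x \<noteq> y"
    and a: "a \<in> X - {x, y}" and b: "b \<in> X - {x, y}"
    and ab: "b \<notin> component_of \<C> (X - {x, y}) a"
  defines "A \<equiv> component_of \<C> (X - {x, y}) a"
    and "B \<equiv> component_of \<C> (X - {x, y}) b"
    and "E \<equiv> component_of \<C> (X - {a} - {x}) y"
  shows "X - {x} - A \<subseteq> E" and "E - B \<in> \<C>"
proof -
  have aA: "a \<in> A" unfolding A_def using a by (intro component_of_self) auto
  have "y \<notin> A" "y \<notin> B" unfolding A_def B_def using component_of_subset by fast+
  have "X - {x} - component_of \<C> (X - {x} - {y}) a \<in> \<C>"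
    by (rule minus_component_connected) (use minus_one assms in auto)
  moreover have "X - {x} - {y} = X - {x, y}" by blast
  ultimately have "X - {x} - A \<in> \<C>" by (simp add: A_def)
  then show sub: "X - {x} - A \<subseteq> E"
    unfolding E_def by (rule component_of_upper) (use \<open>y \<notin> A\<close> aA y \<open>x \<noteq> y\<close> in auto)
  have Ec: "E \<in> \<C>" unfolding E_def by (rule component_of_connected)
  have yE: "y \<in> E" and bE: "b \<in> E"
    using sub y \<open>x \<noteq> y\<close> \<open>y \<notin> A\<close> b ab unfolding A_def by auto
  have "B \<in> \<C>" and bB: "b \<in> B"
    unfolding B_def using b by (auto intro: component_of_connected component_of_self)
  have "B \<inter> A = {}"
    using component_of_eq[of _ "X - {x, y}" a] component_of_eq[of _ "X - {x, y}" b] ab bB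
    unfolding A_def B_def by blast
  then have "B \<subseteq> E - {y}"
    using sub \<open>y \<notin> B\<close> component_of_subset[of \<C> "X - {x, y}" b] unfolding B_def by blast
  moreover have "E - {y} \<subseteq> X - {x, y}"
    unfolding E_def using component_of_subset[of \<C> "X - {a} - {x}" y] by blast
  ultimately have "component_of \<C> (E - {y}) b = B"
    using component_of_upper[OF \<open>B \<in> \<C>\<close> bB] component_of_mono[of "E - {y}"]
    unfolding B_def by (metis subset_antisym)
  then show "E - B \<in> \<C>"
    using minus_component_connected[OF Ec yE bE] by simp
qed

text \<open>
  If the components of \<open>a\<close> and \<open>b\<close> do not exhaust \<open>X - {x, y}\<close>, the second one is not needed to
  hold \<open>X - {a}\<close> together.
\<close>

lemma minus_point_minus_component:
  assumes x: "x \<in> X" and y: "y \<in> X" and "x \<noteq> y"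
    and a: "a \<in> X - {x, y}" and b: "b \<in> X - {x, y}"
    and ab: "b \<notin> component_of \<C> (X - {x, y}) a"
    and r: "r \<in> X - {x, y}" "r \<notin> component_of \<C> (X - {x, y}) a"
      "r \<notin> component_of \<C> (X - {x, y}) b"
  shows "X - {a} - component_of \<C> (X - {x, y}) b \<in> \<C>"
proof -
  define B where "B = component_of \<C> (X - {x, y}) b"
  define Ey where "Ey = component_of \<C> (X - {a} - {x}) y"
  define Ex where "Ex = component_of \<C> (X - {a} - {y}) x"
  note 1 = component_around_end[OF x y \<open>x \<noteq> y\<close> a b ab]
  have swap: "{y, x} = {x, y}" by blast
  note 2 = component_around_end[of y x a b, unfolded swap, OF y x \<open>x \<noteq> y\<close>[symmetric] a b ab]
  have rE: "r \<in> Ey - B" "r \<in> Ex - B"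
    using 1(1) 2(1) r unfolding Ey_def Ex_def B_def by auto
  have "(Ey - B) \<union> (Ex - B) \<in> \<C>"
    by (rule Un_connected[OF _ _ rE]) (use 1(2) 2(2) in \<open>simp_all add: Ey_def Ex_def B_def\<close>)
  moreover have "Ey \<union> Ex = X - {a}"
  proof
    show "Ey \<union> Ex \<subseteq> X - {a}"
      unfolding Ey_def Ex_def using component_of_subset by fast
    \<comment> \<open>What \<open>Ey\<close> misses is connected and contains \<open>x\<close>, but not \<open>y\<close>, so it lies in \<open>Ex\<close>.\<close>
    have "X - {a} - Ey \<in> \<C>"
      unfolding Ey_def by (rule minus_component_connected) (use minus_one a x y in auto)
    moreover have "x \<in> X - {a} - Ey"
      unfolding Ey_def using component_of_subset[of \<C> "X - {a} - {x}" y] x a by blast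
    moreover have "y \<in> Ey"
      unfolding Ey_def using y a \<open>x \<noteq> y\<close> by (intro component_of_self) auto
    ultimately have "X - {a} - Ey \<subseteq> Ex"
      unfolding Ex_def by (intro component_of_upper) auto
    then show "X - {a} \<subseteq> Ey \<union> Ex" by blast
  qed
  ultimately show ?thesis by (simp add: B_def Un_Diff[symmetric])
qed

lemma no_third_component:
  assumes x: "x \<in> X" and y: "y \<in> X" and "x \<noteq> y"
    and a: "a \<in> X - {x, y}" and b: "b \<in> X - {x, y}"
    and ab: "b \<notin> component_of \<C> (X - {x, y}) a"
    and r: "r \<in> X - {x, y}"
  shows "r \<in> component_of \<C> (X - {x, y}) a \<or> r \<in> component_of \<C> (X - {x, y}) b"
proof (rule ccontr)
  define A where "A = component_of \<C> (X - {x, y}) a"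
  define B where "B = component_of \<C> (X - {x, y}) b"
  assume neg: "\<not> ?thesis"
  have aA: "a \<in> A" and bB: "b \<in> B"
    unfolding A_def B_def using a b by (auto intro: component_of_self)
  have disj: "A \<inter> B = {}"
    using component_of_eq[of _ "X - {x, y}" a] component_of_eq[of _ "X - {x, y}" b] ab bB
    unfolding A_def B_def by blast
  have "X - {a} - B \<in> \<C>"
    unfolding B_def
    by (rule minus_point_minus_component[OF x y \<open>x \<noteq> y\<close> a b ab r]) (use neg in auto)
  moreover have "X - {b} - A \<in> \<C>"
    unfolding A_def
    by (rule minus_point_minus_component[OF x y \<open>x \<noteq> y\<close> b a _ r])
      (use neg disj aA in \<open>auto simp: B_def\<close>)
  moreover have "r \<in> X - {a} - B" "r \<in> X - {b} - A"
    using neg r aA bB unfolding A_def B_def by auto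
  ultimately have "(X - {a} - B) \<union> (X - {b} - A) \<in> \<C>"
    by (rule Un_connected)
  moreover have "(X - {a} - B) \<union> (X - {b} - A) = X - {a, b}"
    using disj aA bB by blast
  moreover have "X - {a, b} \<notin> \<C>"
    using a b aA bB disj by (intro minus_two) auto
  ultimately show False by simp
qed

lemma card_components_minus_two:
  assumes x: "x \<in> X" and y: "y \<in> X" and "x \<noteq> y"
  shows "card (conn_components \<C> (X - {x, y})) = 2"
proof -
  define S where "S = X - {x, y}"
  have S: "S \<subseteq> X" "S \<noteq> {}" using minus_two_nonempty[OF x y] by (auto simp: S_def)
  then obtain a where a: "a \<in> S" by blast
  have "component_of \<C> S a \<noteq> S"
    using minus_two[OF assms] component_of_connected[of S a] unfolding S_def by metis
  then obtain b where b: "b \<in> S" "b \<notin> component_of \<C> S a"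
    using component_of_subset[of \<C> S a] by blast
  have "component_of \<C> S r \<in> {component_of \<C> S a, component_of \<C> S b}" if "r \<in> S" for r
    using no_third_component[OF assms, folded S_def, OF a b that] component_of_eq[OF _ S(1)]
    by blast
  then have "component_of \<C> S ` S = {component_of \<C> S a, component_of \<C> S b}"
    using a b by blast
  moreover have "component_of \<C> S a \<noteq> component_of \<C> S b"
    using b component_of_self[OF b(1) S(1)] by blast
  ultimately show ?thesis using conn_components_eq[OF S] by (simp add: S_def)
qed

end

theorem proposition3p5:
  fixes X :: "'a set" and \<C> :: "'a set set" and x y :: 'a
  assumes "two_flimsy_space X \<C>"
    and "x \<in> X" and "y \<in> X" and "x \<noteq> y"
  shows "card (conn_components \<C> (X - {x, y})) = 2"
  using two_flimsy_space.card_components_minus_two[OF assms] .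

end
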